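(* Let $L$ be a finite loop and let $k\geq 2$ be an integer. Then $$0\rightarrow \mathcal{Z}^k(L,\mathbb{Z}_2)\overset{\iota}{\hookrightarrow} \mathcal{Z}^k_\mathcal{L}(L,\mathbb{Z}_2) \xrightarrow{\ \Phi^{-1}\delta\ } \mathcal{B}_\mathcal{L}^k(L,\mathbb{Z}_2)\rightarrow 0$$ is a short exact sequence of abelian groups, where $\iota$ is the natural inclusion and $\Phi^{-1}\delta$ is the map $\psi\mapsto\Phi^{-1}(\delta_\psi)$, with $\Phi:\mathcal{B}^k_{\mathcal{L}}(L,\mathbb{Z}_2)\to\mathrm{Im}(\delta^2)$ the isomorphism $[\delta_f]\mapsto\delta^2(f)$.
   Context: A loop is a finite set $L$ with a binary operation having an identity element $e$ and such that for all $a,b\in L$ the equations $ax=b$ and $ya=b$ have unique solutions $x,y\in L$. Let $\mathbb{Z}_2=(\mathbb{F}_2,+)$ and let $\mathcal{C}^k(L,\mathbb{Z}_2)$ be the abelian group of all functions ($k$-cochains) $L^k\to\mathbb{Z}_2$ under pointwise addition. The coboundary operator $\delta:\mathcal{C}^k(L,\mathbb{Z}_2)\to\mathcal{C}^{k+1}(L,\mathbb{Z}_2)$, $f\mapsto\delta_f$, is $$\delta_f(a_1,\ldots,a_{k+1})=f(a_1,\ldots,a_k)+f(a_2,\ldots,a_{k+1})+\sum_{i=1}^k f(a_1,\ldots,a_ia_{i+1},\ldots,a_{k+1}).$$ Write $\delta^2(f)=\delta(\delta_f)$ and $\mathrm{Im}(\delta^2)=\{\delta^2(f): f\in\mathcal{C}^{k-1}(L,\mathbb{Z}_2)\}\subseteq\mathcal{C}^{k+1}(L,\mathbb{Z}_2)$.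 Put $\mathcal{Z}^k(L,\mathbb{Z}_2)=\{\psi\in\mathcal{C}^k(L,\mathbb{Z}_2):\delta_\psi=0\}$ ($k$-cocycles) and $\mathcal{Z}^k_{\mathcal{L}}(L,\mathbb{Z}_2)=\{\psi\in\mathcal{C}^k(L,\mathbb{Z}_2):\delta_\psi\in\mathrm{Im}(\delta^2)\}$ ($k$-loop-cocycles). The associative obstruction set is $\mathcal{O}(L)=\bigcup\{(ab)c,\,a(bc)\}$, the union over all $a,b,c\in L$ with $(ab)c\neq a(bc)$. Let $\mathcal{C}_0^{k-1}(L,\mathbb{Z}_2)$ be the subgroup of those $f\in\mathcal{C}^{k-1}(L,\mathbb{Z}_2)$ with $f(a_1,\ldots,a_{k-1})=0$ whenever some $a_i\notin\mathcal{O}(L)$. Put $\mathcal{B}_0^k(L,\mathbb{Z}_2)=\{\delta_f: f\in\mathcal{C}_0^{k-1}(L,\mathbb{Z}_2)\}$ and $\mathcal{B}_{\mathcal{L}}^k(L,\mathbb{Z}_2)=\mathcal{B}_0^k(L,\mathbb{Z}_2)/\big(\mathcal{B}_0^k(L,\mathbb{Z}_2)\cap\mathcal{Z}^k(L,\mathbb{Z}_2)\big)$, the class of $\delta_f$ being denoted $[\delta_f]$. The map $\Phi:\mathcal{B}^k_{\mathcal{L}}(L,\mathbb{Z}_2)\to\mathrm{Im}(\delta^2)$, $[\delta_f]\mapsto\delta^2(f)$ ($f\in\mathcal{C}_0^{k-1}(L,\mathbb{Z}_2)$), is an isomorphism of abelian groups (established separately in the source).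
   Formalization: For k > 2 the formal theorem assumes that Φ is an isomorphism; with C_0 as defined this can fail (k = 3, L a nonassociative inverse-property loop, where e ∉ O(L)), and then the sequence is not exact. For k = 2 nothing is assumed. *)

theory Defs
  imports "HOL-Algebra.Product_Groups" "HOL-Algebra.Coset" "HOL-Library.Z2"
begin

locale finite_loop =
  fixes L (structure)
  assumes finite_carrier: "finite (carrier L)"
    and m_closed: "\<lbrakk>a \<in> carrier L; b \<in> carrier L\<rbrakk> \<Longrightarrow> a \<otimes> b \<in> carrier L"
    and one_closed: "\<one> \<in> carrier L"
    and l_one: "a \<in> carrier L \<Longrightarrow> \<one> \<otimes> a = a"
    and r_one: "a \<in> carrier L \<Longrightarrow> a \<otimes> \<one> = a"
    and l_solve: "\<lbrakk>a \<in> carrier L; b \<in> carrier L\<rbrakk> \<Longrightarrow> \<exists>!x. x \<in> carrier L \<and> a \<otimes> x = b"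
    and r_solve: "\<lbrakk>a \<in> carrier L; b \<in> carrier L\<rbrakk> \<Longrightarrow> \<exists>!y. y \<in> carrier L \<and> y \<otimes> a = b"

definition Z2_group :: "bit monoid" where
  "Z2_group = \<lparr>carrier = UNIV, mult = (+), one = 0\<rparr>"

text \<open>An element of the \<open>k\<close>-fold power of the loop is a list of length \<open>k\<close>. A cochain is an
  extensional function on these lists, so that equality of cochains is equality of functions.\<close>

definition tuples :: "('a, 'b) monoid_scheme \<Rightarrow> nat \<Rightarrow> 'a list set" where
  "tuples L k = {xs. set xs \<subseteq> carrier L \<and> length xs = k}"

definition cochains :: "('a, 'b) monoid_scheme \<Rightarrow> nat \<Rightarrow> ('a list \<Rightarrow> bit) monoid" where
  "cochains L k = product_group (tuples L k) (\<lambda>_. Z2_group)"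

text \<open>The summand with index \<open>i\<close> (counted from 0) replaces the adjacent entries with indices
  \<open>i\<close> and \<open>i + 1\<close> by their product.\<close>

definition coboundary ::
    "('a, 'b) monoid_scheme \<Rightarrow> nat \<Rightarrow> ('a list \<Rightarrow> bit) \<Rightarrow> 'a list \<Rightarrow> bit" where
  "coboundary L k f = (\<lambda>xs \<in> tuples L (k + 1).
     f (take k xs) + f (drop 1 xs) +
     (\<Sum>i<k. f (take i xs @ [(xs ! i) \<otimes>\<^bsub>L\<^esub> (xs ! (i + 1))] @ drop (i + 2) xs)))"

text \<open>The degree \<open>k\<close> below is that of the loop-cocycles: \<open>coboundary2 L k\<close> takes cochains of
  degree \<open>k - 1\<close> to cochains of degree \<open>k + 1\<close>.\<close>

definition coboundary2 ::
    "('a, 'b) monoid_scheme \<Rightarrow> nat \<Rightarrow> ('a list \<Rightarrow> bit) \<Rightarrow> 'a list \<Rightarrow> bit" where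
  "coboundary2 L k f = coboundary L k (coboundary L (k - 1) f)"

definition im_coboundary2 :: "('a, 'b) monoid_scheme \<Rightarrow> nat \<Rightarrow> ('a list \<Rightarrow> bit) monoid" where
  "im_coboundary2 L k =
     (cochains L (k + 1))\<lparr>carrier := coboundary2 L k ` carrier (cochains L (k - 1))\<rparr>"

definition cocycles :: "('a, 'b) monoid_scheme \<Rightarrow> nat \<Rightarrow> ('a list \<Rightarrow> bit) monoid" where
  "cocycles L k = (cochains L k)\<lparr>carrier :=
     {\<psi> \<in> carrier (cochains L k). coboundary L k \<psi> = \<one>\<^bsub>cochains L (k + 1)\<^esub>}\<rparr>"

definition loop_cocycles :: "('a, 'b) monoid_scheme \<Rightarrow> nat \<Rightarrow> ('a list \<Rightarrow> bit) monoid" where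
  "loop_cocycles L k = (cochains L k)\<lparr>carrier :=
     {\<psi> \<in> carrier (cochains L k). coboundary L k \<psi> \<in> carrier (im_coboundary2 L k)}\<rparr>"

definition assoc_obstruction :: "('a, 'b) monoid_scheme \<Rightarrow> 'a set" where
  "assoc_obstruction L =
     \<Union> {{(a \<otimes>\<^bsub>L\<^esub> b) \<otimes>\<^bsub>L\<^esub> c, a \<otimes>\<^bsub>L\<^esub> (b \<otimes>\<^bsub>L\<^esub> c)} | a b c.
         a \<in> carrier L \<and> b \<in> carrier L \<and> c \<in> carrier L \<and>
         (a \<otimes>\<^bsub>L\<^esub> b) \<otimes>\<^bsub>L\<^esub> c \<noteq> a \<otimes>\<^bsub>L\<^esub> (b \<otimes>\<^bsub>L\<^esub> c)}"

definition cochains0 :: "('a, 'b) monoid_scheme \<Rightarrow> nat \<Rightarrow> ('a list \<Rightarrow> bit) set" where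
  "cochains0 L m = {f \<in> carrier (cochains L m).
     \<forall>xs \<in> tuples L m. (\<exists>a \<in> set xs. a \<notin> assoc_obstruction L) \<longrightarrow> f xs = 0}"

definition coboundaries0 :: "('a, 'b) monoid_scheme \<Rightarrow> nat \<Rightarrow> ('a list \<Rightarrow> bit) monoid" where
  "coboundaries0 L k = (cochains L k)\<lparr>carrier := coboundary L (k - 1) ` cochains0 L (k - 1)\<rparr>"

definition trivial_coboundaries0 :: "('a, 'b) monoid_scheme \<Rightarrow> nat \<Rightarrow> ('a list \<Rightarrow> bit) set" where
  "trivial_coboundaries0 L k = carrier (coboundaries0 L k) \<inter> carrier (cocycles L k)"

definition loop_coboundaries ::
    "('a, 'b) monoid_scheme \<Rightarrow> nat \<Rightarrow> ('a list \<Rightarrow> bit) set monoid" where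
  "loop_coboundaries L k = coboundaries0 L k Mod trivial_coboundaries0 L k"

definition coboundary_class ::
    "('a, 'b) monoid_scheme \<Rightarrow> nat \<Rightarrow> ('a list \<Rightarrow> bit) \<Rightarrow> ('a list \<Rightarrow> bit) set" where
  "coboundary_class L k g = trivial_coboundaries0 L k #>\<^bsub>coboundaries0 L k\<^esub> g"

text \<open>The description is unambiguous on the carrier of \<^term>\<open>loop_coboundaries L k\<close>: two
  representatives of a class differ by a cocycle, hence have the same coboundary.
  \<open>Phi L k\<close> is always an injective homomorphism, and onto \<^term>\<open>im_coboundary2 L k\<close> if
  \<open>k = 2\<close>. If \<open>k > 2\<close>, it need not be onto: for \<open>k = 3\<close> this already fails for a loop of
  order 5, so that there the isomorphism property of \<open>Phi L k\<close> is a genuine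
  hypothesis.\<close>

definition Phi ::
    "('a, 'b) monoid_scheme \<Rightarrow> nat \<Rightarrow> ('a list \<Rightarrow> bit) set \<Rightarrow> 'a list \<Rightarrow> bit" where
  "Phi L k X = (THE u. \<exists>f \<in> cochains0 L (k - 1).
     X = coboundary_class L k (coboundary L (k - 1) f) \<and> u = coboundary2 L k f)"

definition Phi_inv_coboundary ::
    "('a, 'b) monoid_scheme \<Rightarrow> nat \<Rightarrow> ('a list \<Rightarrow> bit) \<Rightarrow> ('a list \<Rightarrow> bit) set" where
  "Phi_inv_coboundary L k \<psi> =
     inv_into (carrier (loop_coboundaries L k)) (Phi L k) (coboundary L k \<psi>)"

text \<open>The library's \<open>short_exact_sequence\<close> requires all groups to have elements of one type,
  which excludes a quotient as the third group.\<close>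

definition short_exact_abelian ::
    "'a monoid \<Rightarrow> 'b monoid \<Rightarrow> 'c monoid \<Rightarrow> ('a \<Rightarrow> 'b) \<Rightarrow> ('b \<Rightarrow> 'c) \<Rightarrow> bool" where
  "short_exact_abelian A B C f g \<longleftrightarrow>
     comm_group A \<and> comm_group B \<and> comm_group C \<and>
     f \<in> mon A B \<and> kernel B C g = f ` carrier A \<and> g \<in> epi B C"

end

theory Submission
  imports Defs
begin

text \<open>
  The coboundary \<open>\<psi> \<mapsto> \<delta>\<^sub>\<psi>\<close> maps the \<open>k\<close>-loop-cocycles onto \<open>Im(\<delta>\<^sup>2)\<close> with kernel the
  \<open>k\<close>-cocycles, and composing it with the inverse of the isomorphism \<open>\<Phi>\<close> changes neither
  surjectivity nor the kernel. For \<open>k = 2\<close> the map \<open>\<Phi>\<close> is an isomorphism by the first isomorphism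
  theorem for \<open>\<delta>\<close> restricted to \<open>\<B>\<^sub>0\<close>: since \<open>\<delta>\<^sup>2(f)(a,b,c) = f((ab)c) + f(a(bc))\<close>, the values of
  \<open>f\<close> outside the associative obstruction set do not affect \<open>\<delta>\<^sup>2(f)\<close>.
\<close>

(* This rule turns sums of bits into propositional formulas, which blocks additive reasoning. *)
declare add_bit_eq_xor [simp del]

section \<open>Subgroups of abelian groups and preimages of subgroups\<close>

lemma comm_group_subgroup:
  assumes "comm_group G" "subgroup H G"
  shows "comm_group (G\<lparr>carrier := H\<rparr>)"
proof -
  interpret comm_group G by fact
  interpret H: group "G\<lparr>carrier := H\<rparr>"
    using assms(2) by (rule subgroup.subgroup_is_group) (rule is_group)
  show ?thesis
    using subgroup.subset[OF assms(2)] by (intro H.group_comm_groupI) (auto intro: m_comm)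
qed

text \<open>Meant for \<delta> and the image of \<open>coboundary2\<close>: the loop-cocycles are by
  definition such a preimage.\<close>

lemma (in group_hom) subgroup_preimage:
  assumes "subgroup K H"
  shows "subgroup {x \<in> carrier G. h x \<in> K} G"
proof -
  interpret K: subgroup K H by fact
  show ?thesis
    by (rule G.subgroupI) (auto intro!: exI[of _ "\<one>\<^bsub>G\<^esub>"])
qed

section \<open>Cochain groups with coefficients in the two-element group\<close>

lemma carrier_cochains: "carrier (cochains L k) = tuples L k \<rightarrow>\<^sub>E UNIV"
  by (simp add: cochains_def Z2_group_def)

lemma mult_cochains: "f \<otimes>\<^bsub>cochains L k\<^esub> g = (\<lambda>xs \<in> tuples L k. f xs + g xs)"
  by (simp add: cochains_def Z2_group_def)

lemma one_cochains: "\<one>\<^bsub>cochains L k\<^esub> = (\<lambda>xs \<in> tuples L k. 0)"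
  by (simp add: cochains_def Z2_group_def)

lemma comm_group_Z2_group: "comm_group Z2_group"
  by (rule comm_groupI)
    \<comment> \<open>The witness for the inverse of \<open>x\<close> is \<open>- x\<close>,
      supplied through \<open>left_minus\<close>.\<close>
    (auto simp: Z2_group_def
      intro!: exI[where P = "\<lambda>y. y + x = 0" for x, OF left_minus])

lemma comm_group_cochains: "comm_group (cochains L k)"
proof -
  interpret group "cochains L k"
    unfolding cochains_def using comm_group_Z2_group
    by (intro product_group) (rule comm_group.axioms(2))
  show ?thesis
    by (rule group_comm_groupI) (simp add: mult_cochains add.commute)
qed

lemma inv_cochains:
  assumes "f \<in> carrier (cochains L k)"
  shows "inv\<^bsub>cochains L k\<^esub> f = f"
proof -
  interpret comm_group "cochains L k" by (rule comm_group_cochains)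
  have "f \<otimes>\<^bsub>cochains L k\<^esub> f = \<one>\<^bsub>cochains L k\<^esub>"
    by (simp add: mult_cochains one_cochains)
  then show ?thesis
    using assms by (intro inv_equality)
qed

lemma subgroup_cochains0: "subgroup (cochains0 L k) (cochains L k)"
proof -
  interpret comm_group "cochains L k" by (rule comm_group_cochains)
  show ?thesis
  proof (rule subgroupI)
    have "\<one>\<^bsub>cochains L k\<^esub> \<in> cochains0 L k"
      unfolding cochains0_def using one_closed by (auto simp: one_cochains)
    then show "cochains0 L k \<noteq> {}" by blast
    show "f \<otimes>\<^bsub>cochains L k\<^esub> g \<in> cochains0 L k"
      if "f \<in> cochains0 L k" "g \<in> cochains0 L k" for f g
      using that m_closed[of f g] unfolding cochains0_def by (auto simp: mult_cochains)
  qed (auto simp: cochains0_def inv_cochains)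
qed

context finite_loop
begin

section \<open>The coboundary homomorphism and the groups of the sequence\<close>

lemma coboundary_hom: "coboundary L k \<in> hom (cochains L k) (cochains L (k + 1))"
proof (rule homI)
  show "coboundary L k f \<in> carrier (cochains L (k + 1))" for f
    by (simp add: coboundary_def carrier_cochains)
  fix f g
  show "coboundary L k (f \<otimes>\<^bsub>cochains L k\<^esub> g) =
      coboundary L k f \<otimes>\<^bsub>cochains L (k + 1)\<^esub> coboundary L k g"
  proof
    fix xs
    show "coboundary L k (f \<otimes>\<^bsub>cochains L k\<^esub> g) xs =
        (coboundary L k f \<otimes>\<^bsub>cochains L (k + 1)\<^esub> coboundary L k g) xs"
    proof (cases "xs \<in> tuples L (k + 1)")
      case True
      then have xs: "set xs \<subseteq> carrier L" "length xs = k + 1"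
        by (auto simp: tuples_def)
      \<comment> \<open>By \<open>mult_cochains\<close> a product takes the value of the sum only on
        \<open>tuples L k\<close>, so every argument occurring in the coboundary formula has to be
        located there.\<close>
      have "take k xs \<in> tuples L k" "drop 1 xs \<in> tuples L k"
        using xs set_take_subset[of k xs] set_drop_subset[of 1 xs] by (auto simp: tuples_def)
      moreover have "take i xs @ [xs ! i \<otimes> xs ! (i + 1)] @ drop (i + 2) xs \<in> tuples L k"
        if "i < k" for i
        using that xs set_take_subset[of i xs] set_drop_subset[of "i + 2" xs]
        by (auto simp: tuples_def intro!: m_closed)
      ultimately show ?thesis
        using True by (simp add: coboundary_def mult_cochains sum.distrib algebra_simps)
    next
      case False
      then show ?thesis
        by (simp add: coboundary_def mult_cochains)
    qed
  qed
qed

lemma coboundary_group_hom: "group_hom (cochains L k) (cochains L (k + 1)) (coboundary L k)"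
  unfolding group_hom_def group_hom_axioms_def
  using comm_group_cochains coboundary_hom by (intro conjI comm_group.axioms(2))

text \<open>The bound on \<open>k\<close> makes \<open>k - 1 + 1\<close> equal to \<open>k\<close>
  despite truncated subtraction.\<close>

lemma coboundary_pred_group_hom:
  assumes "k \<ge> 1"
  shows "group_hom (cochains L (k - 1)) (cochains L k) (coboundary L (k - 1))"
  using coboundary_group_hom[of "k - 1"] assms by simp

lemma subgroup_cocycles: "subgroup (carrier (cocycles L k)) (cochains L k)"
  using group_hom.subgroup_kernel[OF coboundary_group_hom[of k]]
  by (simp add: cocycles_def kernel_def)

lemma subgroup_im_coboundary2:
  assumes "k \<ge> 1"
  shows "subgroup (carrier (im_coboundary2 L k)) (cochains L (k + 1))"
  using group_hom.subgroup_img_is_subgroup[OF coboundary_group_hom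
      group_hom.img_is_subgroup[OF coboundary_pred_group_hom[OF assms]]]
  by (simp add: im_coboundary2_def coboundary2_def[abs_def] image_image)

lemma subgroup_loop_cocycles:
  assumes "k \<ge> 1"
  shows "subgroup (carrier (loop_cocycles L k)) (cochains L k)"
  using group_hom.subgroup_preimage[OF coboundary_group_hom subgroup_im_coboundary2[OF assms]]
  by (simp add: loop_cocycles_def)

lemma subgroup_coboundaries0:
  assumes "k \<ge> 1"
  shows "subgroup (carrier (coboundaries0 L k)) (cochains L k)"
  using group_hom.subgroup_img_is_subgroup[OF coboundary_pred_group_hom[OF assms]
      subgroup_cochains0]
  by (simp add: coboundaries0_def)

lemma comm_group_cocycles: "comm_group (cocycles L k)"
  using comm_group_subgroup[OF comm_group_cochains subgroup_cocycles]
  by (simp add: cocycles_def)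

lemma comm_group_loop_cocycles:
  assumes "k \<ge> 1"
  shows "comm_group (loop_cocycles L k)"
  using comm_group_subgroup[OF comm_group_cochains subgroup_loop_cocycles[OF assms]]
  by (simp add: loop_cocycles_def)

lemma comm_group_im_coboundary2:
  assumes "k \<ge> 1"
  shows "comm_group (im_coboundary2 L k)"
  using comm_group_subgroup[OF comm_group_cochains subgroup_im_coboundary2[OF assms]]
  by (simp add: im_coboundary2_def)

lemma comm_group_coboundaries0:
  assumes "k \<ge> 1"
  shows "comm_group (coboundaries0 L k)"
  using comm_group_subgroup[OF comm_group_cochains subgroup_coboundaries0[OF assms]]
  by (simp add: coboundaries0_def)

lemma subgroup_trivial_coboundaries0:
  assumes "k \<ge> 1"
  shows "subgroup (trivial_coboundaries0 L k) (coboundaries0 L k)"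
proof -
  interpret comm_group "cochains L k" by (rule comm_group_cochains)
  have "subgroup (trivial_coboundaries0 L k) (cochains L k)"
    unfolding trivial_coboundaries0_def
    using assms by (intro subgroups_Inter_pair subgroup_coboundaries0 subgroup_cocycles)
  then have "subgroup (trivial_coboundaries0 L k)
      ((cochains L k)\<lparr>carrier := carrier (coboundaries0 L k)\<rparr>)"
    using assms
    by (intro subgroup_incl subgroup_coboundaries0) (auto simp: trivial_coboundaries0_def)
  then show ?thesis
    by (simp add: coboundaries0_def)
qed

lemma comm_group_loop_coboundaries:
  assumes "k \<ge> 1"
  shows "comm_group (loop_coboundaries L k)"
  unfolding loop_coboundaries_def
  using assms comm_group_coboundaries0 subgroup_trivial_coboundaries0
  by (intro comm_group.abelian_FactGroup)

lemma coboundary_hom_loop_cocycles: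
  "coboundary L k \<in> hom (loop_cocycles L k) (im_coboundary2 L k)"
  using coboundary_hom[of k] by (auto simp: hom_def loop_cocycles_def im_coboundary2_def)

text \<open>Every element of the target is \<delta> of some \<open>coboundary L (k - 1) f\<close>,
  and that cochain is itself a loop-cocycle. This yields the surjectivity in the exact
  sequence.\<close>

lemma coboundary_image_loop_cocycles:
  assumes "k \<ge> 1"
  shows "coboundary L k ` carrier (loop_cocycles L k) = carrier (im_coboundary2 L k)"
proof -
  have "coboundary L (k - 1) f \<in> carrier (cochains L k)"
    if "f \<in> carrier (cochains L (k - 1))" for f
    using group_hom.hom_closed[OF coboundary_pred_group_hom[OF assms] that] .
  then show ?thesis
    by (auto simp: loop_cocycles_def im_coboundary2_def coboundary2_def)
qed

lemma coboundaries0_subset_loop_cocycles: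
  assumes "k \<ge> 1"
  shows "carrier (coboundaries0 L k) \<subseteq> carrier (loop_cocycles L k)"
proof -
  have "coboundary L (k - 1) f \<in> carrier (cochains L k)"
    if "f \<in> carrier (cochains L (k - 1))" for f
    using group_hom.hom_closed[OF coboundary_pred_group_hom[OF assms] that] .
  then show ?thesis
    by (auto simp: coboundaries0_def loop_cocycles_def im_coboundary2_def coboundary2_def
        cochains0_def)
qed

section \<open>The map \<open>Phi\<close> on classes\<close>

lemma coboundary_on_coboundary_class:
  assumes "k \<ge> 1" "g \<in> carrier (coboundaries0 L k)" "h \<in> coboundary_class L k g"
  shows "coboundary L k h = coboundary L k g"
proof -
  interpret \<delta>: group_hom "cochains L k" "cochains L (k + 1)" "coboundary L k"
    by (rule coboundary_group_hom)
  \<comment> \<open>Members of the class differ from \<open>g\<close> by a cocycle \<open>t\<close>,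
    which the additive map \<delta> sends to zero.\<close>
  obtain t where t: "t \<in> trivial_coboundaries0 L k" "h = t \<otimes>\<^bsub>cochains L k\<^esub> g"
    using assms(3) by (auto simp: coboundary_class_def r_coset_def coboundaries0_def)
  have "g \<in> carrier (cochains L k)"
    using assms(2) subgroup.subset[OF subgroup_coboundaries0[OF assms(1)]] by blast
  moreover have "t \<in> carrier (cochains L k)" "coboundary L k t = \<one>\<^bsub>cochains L (k + 1)\<^esub>"
    using t(1) by (simp_all add: trivial_coboundaries0_def cocycles_def)
  ultimately show ?thesis
    using t(2) \<delta>.hom_mult \<delta>.H.l_one \<delta>.hom_closed by metis
qed

text \<open>The definite description in \<open>Phi\<close> is resolved here: two cochains
  representing the same class have the same second coboundary, because \<delta> is constant on
  classes.\<close>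

lemma Phi_coboundary_class:
  assumes "k \<ge> 1" "f \<in> cochains0 L (k - 1)"
  shows "Phi L k (coboundary_class L k (coboundary L (k - 1) f)) = coboundary2 L k f"
  unfolding Phi_def
proof (rule the_equality)
  fix u
  assume "\<exists>f' \<in> cochains0 L (k - 1). coboundary_class L k (coboundary L (k - 1) f) =
      coboundary_class L k (coboundary L (k - 1) f') \<and> u = coboundary2 L k f'"
  then obtain f' where f': "f' \<in> cochains0 L (k - 1)" "u = coboundary2 L k f'"
      "coboundary_class L k (coboundary L (k - 1) f) =
       coboundary_class L k (coboundary L (k - 1) f')"
    by blast
  interpret B: comm_group "coboundaries0 L k"
    using assms(1) by (rule comm_group_coboundaries0)
  have "coboundary L (k - 1) f' \<in> coboundary_class L k (coboundary L (k - 1) f')"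
    unfolding coboundary_class_def using f'(1) assms(1)
    by (intro B.rcos_self subgroup_trivial_coboundaries0) (auto simp: coboundaries0_def)
  then have "coboundary L k (coboundary L (k - 1) f') = coboundary L k (coboundary L (k - 1) f)"
    using assms f'(3)
    by (intro coboundary_on_coboundary_class) (auto simp: coboundaries0_def)
  then show "u = coboundary2 L k f"
    by (simp add: f'(2) coboundary2_def)
qed (use assms in blast)

text \<open>The subgroup divided out is exactly the kernel of \<delta> on
  \<open>coboundaries0 L k\<close>, so the first isomorphism theorem leaves only surjectivity to be
  supplied.\<close>

lemma Phi_iso_if_onto:
  assumes "k \<ge> 1"
    and onto: "coboundary L k ` carrier (coboundaries0 L k) = carrier (im_coboundary2 L k)"
  shows "Phi L k \<in> iso (loop_coboundaries L k) (im_coboundary2 L k)"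
proof -
  interpret B: comm_group "coboundaries0 L k"
    using assms(1) by (rule comm_group_coboundaries0)
  interpret I: comm_group "im_coboundary2 L k"
    using assms(1) by (rule comm_group_im_coboundary2)
  interpret Q: comm_group "loop_coboundaries L k"
    using assms(1) by (rule comm_group_loop_coboundaries)
  have "coboundary L k \<in> hom (coboundaries0 L k) (im_coboundary2 L k)"
    using coboundary_hom_loop_cocycles[of k] coboundaries0_subset_loop_cocycles[OF assms(1)]
    by (auto simp: hom_def Pi_iff coboundaries0_def loop_cocycles_def subset_iff)
  then interpret \<delta>: group_hom "coboundaries0 L k" "im_coboundary2 L k" "coboundary L k"
    by unfold_locales
  have "carrier (coboundaries0 L k) \<subseteq> carrier (cochains L k)"
    using subgroup.subset[OF subgroup_coboundaries0[OF assms(1)]] .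
  then have "kernel (coboundaries0 L k) (im_coboundary2 L k) (coboundary L k) =
      trivial_coboundaries0 L k"
    by (auto simp: kernel_def trivial_coboundaries0_def cocycles_def im_coboundary2_def)
  \<comment> \<open>The induced isomorphism comes as the common value of \<delta> on a coset; it
    remains to identify it with \<open>Phi\<close> on the carrier.\<close>
  then have "(\<lambda>X. the_elem (coboundary L k ` X)) \<in> iso (loop_coboundaries L k) (im_coboundary2 L k)"
    using \<delta>.FactGroup_iso_set[OF onto] by (simp add: loop_coboundaries_def)
  then show ?thesis
  proof (rule Q.iso_eq)
    fix X
    assume "X \<in> carrier (loop_coboundaries L k)"
    then obtain g where g: "g \<in> carrier (coboundaries0 L k)" "X = coboundary_class L k g"
      by (auto simp: loop_coboundaries_def carrier_FactGroup coboundary_class_def)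
    then obtain f where f: "f \<in> cochains0 L (k - 1)" "g = coboundary L (k - 1) f"
      by (auto simp: coboundaries0_def)
    \<comment> \<open>Since \<open>X\<close> is nonempty and \<delta> is constant on it, the image
      of \<open>X\<close> is a singleton.\<close>
    have "g \<in> X"
      unfolding g(2) coboundary_class_def
      using g(1) subgroup_trivial_coboundaries0[OF assms(1)] by (rule B.rcos_self)
    then have "coboundary L k ` X = {coboundary L k g}"
      using coboundary_on_coboundary_class[OF assms(1) g(1)] unfolding g(2) by blast
    then show "Phi L k X = the_elem (coboundary L k ` X)"
      using Phi_coboundary_class[OF assms(1) f(1)] by (simp add: g(2) f(2) coboundary2_def)
  qed
qed

section \<open>Surjectivity of \<open>Phi\<close> in degree 2\<close>

lemma coboundary2_2:
  assumes "a \<in> carrier L" "b \<in> carrier L" "c \<in> carrier L"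
  shows "coboundary2 L 2 f [a, b, c] = f [(a \<otimes> b) \<otimes> c] + f [a \<otimes> (b \<otimes> c)]"
proof -
  have \<delta>1: "coboundary L 1 f [x, y] = f [x] + f [y] + f [x \<otimes> y]"
    if "x \<in> carrier L" "y \<in> carrier L" for x y
    using that by (simp add: coboundary_def tuples_def)
  have cancel: "x + x = 0" "x + (x + y) = y" for x y :: bit
    by (simp_all flip: add.assoc)
  have "coboundary2 L 2 f [a, b, c] =
      coboundary L 1 f [a, b] + coboundary L 1 f [b, c] +
      (coboundary L 1 f [a \<otimes> b, c] + coboundary L 1 f [a, b \<otimes> c])"
    using assms
    by (simp add: coboundary2_def coboundary_def[of L 2] tuples_def lessThan_nat_numeral
        lessThan_Suc add.commute)
  \<comment> \<open>The values of \<open>f\<close> at \<open>a\<close>, \<open>b\<close>,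
    \<open>c\<close>, \<open>a \<otimes> b\<close> and \<open>b \<otimes> c\<close> each occur twice
    and cancel in characteristic 2.\<close>
  also have "\<dots> = f [(a \<otimes> b) \<otimes> c] + f [a \<otimes> (b \<otimes> c)]"
    using assms
    by (simp add: \<delta>1 m_closed cancel add.commute add.left_commute del: One_nat_def)
  finally show ?thesis .
qed

lemma coboundary_onto_2:
  "coboundary L 2 ` carrier (coboundaries0 L 2) = carrier (im_coboundary2 L 2)"
proof
  show "coboundary L 2 ` carrier (coboundaries0 L 2) \<subseteq> carrier (im_coboundary2 L 2)"
    by (auto simp: coboundaries0_def im_coboundary2_def coboundary2_def cochains0_def)
  show "carrier (im_coboundary2 L 2) \<subseteq> coboundary L 2 ` carrier (coboundaries0 L 2)"
  proof
    fix u
    assume "u \<in> carrier (im_coboundary2 L 2)"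
    then obtain f where u: "u = coboundary2 L 2 f"
      by (auto simp: im_coboundary2_def)
    \<comment> \<open>Cutting \<open>f\<close> off outside the obstruction set gives a preimage in
      \<open>cochains0\<close>.\<close>
    define f0 where "f0 = (\<lambda>xs \<in> tuples L 1. if set xs \<subseteq> assoc_obstruction L then f xs else 0)"
    have f0: "f0 \<in> cochains0 L 1"
      by (auto simp: f0_def cochains0_def carrier_cochains)
    have "coboundary2 L 2 f0 = coboundary2 L 2 f"
    proof
      fix xs
      show "coboundary2 L 2 f0 xs = coboundary2 L 2 f xs"
      proof (cases "xs \<in> tuples L 3")
        case True
        then obtain a b c where xs: "xs = [a, b, c]"
          and abc: "a \<in> carrier L" "b \<in> carrier L" "c \<in> carrier L"
          by (auto simp: tuples_def numeral_3_eq_3 length_Suc_conv)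
        show ?thesis
        \<comment> \<open>For an associating triple both sides have the form \<open>x + x\<close>
          and vanish. Otherwise both products lie in the obstruction set, where \<open>f0\<close>
          agrees with \<open>f\<close>.\<close>
        proof (cases "(a \<otimes> b) \<otimes> c = a \<otimes> (b \<otimes> c)")
          case True
          then show ?thesis
            using abc by (simp add: xs coboundary2_2)
        next
          case False
          then have "(a \<otimes> b) \<otimes> c \<in> assoc_obstruction L" "a \<otimes> (b \<otimes> c) \<in> assoc_obstruction L"
            using abc unfolding assoc_obstruction_def by blast+
          then show ?thesis
            using abc by (simp add: xs coboundary2_2 f0_def tuples_def m_closed)
        qed
      next
        case False
        \<comment> \<open>Off the triples both sides are \<open>undefined\<close>, since
          coboundaries are extensional.\<close>
        then show ?thesis
          by (simp add: coboundary2_def coboundary_def[of L 2])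
      qed
    qed
    then show "u \<in> coboundary L 2 ` carrier (coboundaries0 L 2)"
      using imageI[OF imageI[OF f0, of "coboundary L 1"], of "coboundary L 2"] u
      by (simp add: coboundaries0_def coboundary2_def)
  qed
qed

end

section \<open>The short exact sequence\<close>

theorem theorem2p7:
  fixes L :: "('a, 'b) monoid_scheme" and k :: nat
  assumes "finite_loop L" and "k \<ge> 2"
    and "k > 2 \<Longrightarrow> Phi L k \<in> iso (loop_coboundaries L k) (im_coboundary2 L k)"
  shows "short_exact_abelian (cocycles L k) (loop_cocycles L k) (loop_coboundaries L k)
           (\<lambda>\<psi>. \<psi>) (Phi_inv_coboundary L k)"
proof -
  interpret finite_loop L by fact
  have k: "k \<ge> 1" using assms(2) by simp
  interpret I: comm_group "im_coboundary2 L k" using k by (rule comm_group_im_coboundary2)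
  interpret Q: comm_group "loop_coboundaries L k" using k by (rule comm_group_loop_coboundaries)
  have "Phi L k \<in> iso (loop_coboundaries L k) (im_coboundary2 L k)"
    using assms(2,3) Phi_iso_if_onto[OF _ coboundary_onto_2] by (cases "k = 2") auto
  then have inv: "inv_into (carrier (loop_coboundaries L k)) (Phi L k)
      \<in> iso (im_coboundary2 L k) (loop_coboundaries L k)" (is "?\<Psi> \<in> _")
    by (rule Q.iso_set_sym)
  then interpret \<Psi>: group_hom "im_coboundary2 L k" "loop_coboundaries L k" ?\<Psi>
    by unfold_locales (simp add: iso_def)
  \<comment> \<open>Through this factorization surjectivity follows from that of the two factors,
    and the kernel is that of \<delta> because \<open>?\<Psi>\<close> is injective.\<close>
  have comp: "Phi_inv_coboundary L k = ?\<Psi> \<circ> coboundary L k"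
    by (simp add: Phi_inv_coboundary_def fun_eq_iff)
  have inj: "inj_on ?\<Psi> (carrier (im_coboundary2 L k))"
    and onto: "?\<Psi> ` carrier (im_coboundary2 L k) = carrier (loop_coboundaries L k)"
    using inv by (auto simp: iso_def bij_betw_def)
  have one: "\<one>\<^bsub>im_coboundary2 L k\<^esub> = \<one>\<^bsub>cochains L (k + 1)\<^esub>"
    by (simp add: im_coboundary2_def)
  have "Phi_inv_coboundary L k \<in> epi (loop_cocycles L k) (loop_coboundaries L k)"
    using hom_compose[OF coboundary_hom_loop_cocycles \<Psi>.homh]
    unfolding epi_def comp
    by (simp only: mem_Collect_eq image_comp[symmetric] coboundary_image_loop_cocycles[OF k] onto
        simp_thms)
  moreover have "kernel (loop_cocycles L k) (loop_coboundaries L k) (Phi_inv_coboundary L k) =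
      carrier (cocycles L k)"
  proof -
    have "Phi_inv_coboundary L k \<psi> = \<one>\<^bsub>loop_coboundaries L k\<^esub> \<longleftrightarrow>
        coboundary L k \<psi> = \<one>\<^bsub>cochains L (k + 1)\<^esub>"
      if "\<psi> \<in> carrier (loop_cocycles L k)" for \<psi>
      using that inj_on_eq_iff[OF inj _ I.one_closed] unfolding comp one[symmetric]
      by (simp add: loop_cocycles_def)
    then have "kernel (loop_cocycles L k) (loop_coboundaries L k) (Phi_inv_coboundary L k) =
        {\<psi> \<in> carrier (loop_cocycles L k). coboundary L k \<psi> = \<one>\<^bsub>cochains L (k + 1)\<^esub>}"
      unfolding kernel_def by blast
    also have "\<dots> = carrier (cocycles L k)"
      \<comment> \<open>Zero lies in the image of \<open>coboundary2\<close>, so every cocycle is a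
        loop-cocycle.\<close>
      using I.one_closed unfolding one by (auto simp: cocycles_def loop_cocycles_def)
    finally show ?thesis .
  qed
  \<comment> \<open>The kernel equation also shows that the inclusion lands in the
    loop-cocycles.\<close>
  moreover from this have "(\<lambda>\<psi>. \<psi>) \<in> mon (cocycles L k) (loop_cocycles L k)"
    by (auto simp: mon_def hom_def kernel_def cocycles_def loop_cocycles_def)
  ultimately show ?thesis
    using k by (simp add: short_exact_abelian_def comm_group_cocycles comm_group_loop_cocycles
        comm_group_loop_coboundaries)
qed

end
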